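(* Let $q$ be a polynomial on $\mathbf{R}$ with real coefficients and degree $m \geq 2$, and let $s, \theta > 0$. Define the operator $T$ by $(Tf)(x) = e^{i q(x)} f(x)$, $x \in \mathbf{R}$. If $$1 < s < \theta m - \max(\theta, 1),$$ and $\theta > 1$ if $m = 3$, then $T \Sigma_\theta^s(\mathbf{R}) \nsubseteq \Sigma_\theta^s(\mathbf{R})$.
   Context: Notation: $\mathbf{N} = \{0,1,2,\dots\}$, $D = i^{-1}\frac{d}{dx}$. For $\theta, s, h > 0$, $\mathcal{S}_{\theta,h}^s(\mathbf{R})$ is the space of all $f \in C^\infty(\mathbf{R})$ such that $$\sup_{\alpha,\beta \in \mathbf{N},\ x \in \mathbf{R}} \frac{|x^\alpha D^\beta f(x)|}{h^{\alpha+\beta}\, \alpha!^\theta\, \beta!^s} < \infty.$$ The Beurling type Gelfand--Shilov space is $\Sigma_\theta^s(\mathbf{R}) = \bigcap_{h>0} \mathcal{S}_{\theta,h}^s(\mathbf{R})$. *)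

theory Defs
  imports "HOL-Analysis.Analysis" "HOL-Computational_Algebra.Polynomial"
begin

(* vector_derivative is total, so differentiability is required at every order and every point. *)
definition smooth :: "(real \<Rightarrow> complex) \<Rightarrow> bool" where
  "smooth f \<longleftrightarrow>
     (\<forall>n x. ((\<lambda>g y. vector_derivative g (at y)) ^^ n) f differentiable (at x))"

definition D :: "(real \<Rightarrow> complex) \<Rightarrow> real \<Rightarrow> complex" where
  "D f x = inverse \<i> * vector_derivative f (at x)"

definition GS :: "real \<Rightarrow> real \<Rightarrow> real \<Rightarrow> (real \<Rightarrow> complex) set" where
  "GS \<theta> s h = {f. smooth f \<and>
     bdd_above (range (\<lambda>(\<alpha>::nat, \<beta>::nat, x::real).
       cmod (complex_of_real x ^ \<alpha> * (D ^^ \<beta>) f x) /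
         (h ^ (\<alpha> + \<beta>) * fact \<alpha> powr \<theta> * fact \<beta> powr s)))}"

definition GS_Beurling :: "real \<Rightarrow> real \<Rightarrow> (real \<Rightarrow> complex) set" where
  "GS_Beurling \<theta> s = (\<Inter>h\<in>{0<..}. GS \<theta> s h)"

definition chirp :: "real poly \<Rightarrow> (real \<Rightarrow> complex) \<Rightarrow> real \<Rightarrow> complex" where
  "chirp q f x = exp (\<i> * complex_of_real (poly q x)) * f x"

end

theory Submission
  imports Defs "HOL-Complex_Analysis.Cauchy_Integral_Formula"
begin

text \<open>One function refutes the inclusion, namely \<open>f x = exp (- (1 + x\<^sup>2) powr p)\<close>, which decays like
\<open>exp (- \<bar>x\<bar> powr (1 / r))\<close> for \<open>r = 1 / (2 * p)\<close>. The hypotheses on \<open>s\<close> and \<open>\<theta>\<close> leave room for an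
\<open>r < \<theta>\<close> with \<open>s < r * (m - 1)\<close> and \<open>2 < r * m\<close>.

The function \<open>f\<close> belongs to the Beurling space because it continues holomorphically to a strip around
the real axis, with a decay of the same kind there. Cauchy's inequality bounds its \<open>n\<close>-th derivative by
\<open>fact n / \<delta> ^ n\<close> times that decay, and the decay bounds \<open>\<bar>x\<bar> ^ n\<close> by \<open>fact n powr r\<close> up to a
geometric factor. Since \<open>1 < s\<close> and \<open>r < \<theta>\<close>, the factorials in the definition of the space are larger by
positive powers of factorials, which absorb all geometric factors
(\<open>stretched_exp_in_GS_Beurling\<close>).

The chirped function \<open>F = exp (\<i> * q) * f\<close> oscillates too fast. At a large point \<open>x\<close> its local frequency
is \<open>N = q' x\<close>, of size \<open>x ^ (m - 1)\<close>. Sampled at \<open>n + 1\<close> points with the half period \<open>t = pi / \<bar>N\<bar>\<close> as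
spacing, \<open>F\<close> alternates in sign up to a common phase, as long as the quadratic error
\<open>q'' * (n * t)\<^sup>2\<close>, of size \<open>n\<^sup>2 * x powr (- m)\<close>, stays small. An \<open>n\<close>-th difference of alternating samples
of size \<open>b\<close> has size at least \<open>2 ^ n * b\<close>, while it is at most \<open>t ^ n\<close> times the supremum of the \<open>n\<close>-th
derivative (\<open>alternating_samples_bound\<close>). At \<open>x = n powr r\<close> the decay of \<open>f\<close> costs only a factor
\<open>exp (- L * n)\<close>, the quadratic error is of the order \<open>n powr (2 - r * m)\<close>, which tends to \<open>0\<close>, and the
supremum of the \<open>n\<close>-th derivative is at least of the order \<open>(c * n powr (r * (m - 1))) ^ n\<close>, beyond any
\<open>C * fact n powr s\<close> (\<open>chirp_stretched_exp_derivatives_outgrow\<close>).\<close>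

section \<open>Powers against powers of factorials\<close>

text \<open>The term \<open>L ^ n / fact n\<close> of the series of \<open>exp L\<close> is at most \<open>exp L\<close>; taking \<open>L = K powr (1 / \<epsilon>)\<close> and
raising to the power \<open>\<epsilon>\<close> gives the claim. With \<open>K\<close> constant the bound absorbs every geometric factor
into a small power of a factorial; with \<open>K\<close> proportional to \<open>\<bar>x\<bar>\<close> it bounds monomials against
stretched exponentials.\<close>

lemma power_le_exp_fact_powr:
  fixes K \<epsilon> :: real
  assumes "K \<ge> 0" "\<epsilon> > 0"
  shows "K ^ n \<le> exp (\<epsilon> * K powr (1 / \<epsilon>)) * fact n powr \<epsilon>"
proof (cases "K = 0")
  case True
  then show ?thesis using assms by (cases n) auto
next
  case False
  with assms have K: "K > 0" by simp
  define L where "L = K powr (1 / \<epsilon>)"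
  have L: "L > 0" using K by (simp add: L_def)
  have "(\<Sum>k\<in>{n}. L ^ k /\<^sub>R fact k) \<le> (\<Sum>k. L ^ k /\<^sub>R fact k)"
    by (rule sum_le_suminf[OF summable_exp_generic]) (use L in auto)
  then have "L ^ n / fact n \<le> exp L"
    by (simp add: exp_def divide_inverse mult.commute)
  then have "L ^ n \<le> exp L * fact n" by (simp add: divide_le_eq)
  then have "(L ^ n) powr \<epsilon> \<le> (exp L * fact n) powr \<epsilon>"
    using L assms by (intro powr_mono2) auto
  moreover have "(L ^ n) powr \<epsilon> = K ^ n"
    using K L assms by (simp add: L_def powr_powr flip: powr_realpow)
  moreover have "(exp L * fact n) powr \<epsilon> = exp (\<epsilon> * L) * fact n powr \<epsilon>"
    by (simp add: powr_mult exp_powr_real mult.commute)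
  ultimately show ?thesis by (simp add: L_def)
qed

section \<open>Finite differences of alternating samples\<close>

text \<open>The sequence \<open>G\<close> consists of a function and its successive derivatives. Passing from \<open>G k\<close> to
\<open>\<lambda>y. G k y - G k (y + t)\<close> doubles the lower bound for the alternating samples, because the two terms
have opposite signs, and by the mean value inequality it costs one derivative and a factor \<open>t\<close> in the
upper bound. After \<open>n\<close> steps a single sample remains. The factor \<open>u\<close> removes a common phase.\<close>

lemma alternating_samples_bound:
  fixes G :: "nat \<Rightarrow> real \<Rightarrow> complex"
  assumes "\<And>k y. (G k has_vector_derivative G (Suc k) y) (at y)"
    and "\<And>y. cmod (G n y) \<le> M"
    and "cmod u = 1" and t: "t \<ge> 0"
    and "\<And>j. j \<le> n \<Longrightarrow> b \<le> Re (u * (-1) ^ j * G 0 (x + real j * t))"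
  shows "2 ^ n * b \<le> t ^ n * M"
  using assms(1,2,3,5)
proof (induction n arbitrary: G M b)
  case 0
  have "b \<le> Re (u * G 0 x)" using "0.prems"(4)[of 0] by simp
  also have "\<dots> \<le> cmod (u * G 0 x)" by (rule complex_Re_le_cmod)
  also have "\<dots> \<le> M" using "0.prems"(2)[of x] "0.prems"(3) by (simp add: norm_mult)
  finally show ?case by simp
next
  case (Suc n)
  define H where "H k y = G k y - G k (y + t)" for k y
  have "2 ^ n * (2 * b) \<le> t ^ n * (t * M)"
  proof (rule Suc.IH[of H])
    fix k y
    have "((\<lambda>y. y + t) has_vector_derivative 1) (at y)"
      by (auto intro!: derivative_eq_intros
               simp flip: has_real_derivative_iff_has_vector_derivative)
    then have "((\<lambda>y. G k (y + t)) has_vector_derivative G (Suc k) (y + t)) (at y)"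
      using vector_diff_chain_at[of "\<lambda>y. y + t" 1 y "G k" "G (Suc k) (y + t)"] Suc.prems(1)
      by (simp add: o_def)
    then show "(H k has_vector_derivative H (Suc k) y) (at y)"
      unfolding H_def by (intro has_vector_derivative_diff Suc.prems(1))
  next
    fix y
    have "norm (G n y - G n (y + t)) \<le> M * norm (y - (y + t))"
    proof (rule differentiable_bound[of UNIV "G n" "\<lambda>y h. h *\<^sub>R G (Suc n) y"])
      fix z :: real
      show "(G n has_derivative (\<lambda>h. h *\<^sub>R G (Suc n) z)) (at z within UNIV)"
        using Suc.prems(1) by (simp add: has_vector_derivative_def)
      show "onorm (\<lambda>h. h *\<^sub>R G (Suc n) z) \<le> M"
        using Suc.prems(2)[of z] by (simp add: onorm_scaleR_left bounded_linear_ident onorm_id)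
    qed auto
    then show "cmod (H n y) \<le> t * M" using t by (simp add: H_def mult.commute)
  next
    fix j assume "j \<le> n"
    then show "2 * b \<le> Re (u * (-1) ^ j * H 0 (x + real j * t))"
      using Suc.prems(4)[of j] Suc.prems(4)[of "Suc j"]
      by (simp add: H_def algebra_simps)
  qed (use Suc.prems in auto)
  then show ?case by (simp add: mult_ac)
qed

section \<open>Derivatives of elements of the Gelfand-Shilov spaces\<close>

abbreviation vderiv :: "(real \<Rightarrow> complex) \<Rightarrow> real \<Rightarrow> complex" where
  "vderiv g y \<equiv> vector_derivative g (at y)"

lemma smooth_has_vector_derivative:
  assumes "smooth f"
  shows "((vderiv ^^ n) f has_vector_derivative (vderiv ^^ Suc n) f x) (at x)"
  using assms by (simp add: smooth_def vector_derivative_works[symmetric])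

text \<open>The factors \<open>inverse \<i>\<close> in \<open>D\<close> have modulus one. Smoothness is what lets them be pulled out of the
iterated derivatives.\<close>

lemma cmod_D_power:
  assumes "smooth f"
  shows "cmod ((D ^^ n) f x) = cmod ((vderiv ^^ n) f x)"
proof -
  have "(D ^^ n) f = (\<lambda>y. inverse \<i> ^ n * (vderiv ^^ n) f y)"
  proof (induction n)
    case (Suc n)
    have "D (\<lambda>y. inverse \<i> ^ n * (vderiv ^^ n) f y) y = inverse \<i> ^ Suc n * (vderiv ^^ Suc n) f y" for y
      using vector_derivative_at[OF has_vector_derivative_mult_right[OF smooth_has_vector_derivative[OF assms, of n y]]]
      by (simp add: D_def)
    then show ?case by (simp only: funpow.simps o_apply Suc.IH)
  qed simp
  then show ?thesis by (simp add: norm_mult norm_power norm_inverse)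
qed

text \<open>The case \<open>\<alpha> = 0\<close> and \<open>h = 1\<close> of the definition, which is all that the lower bound for the chirped
function has to contradict.\<close>

lemma GS_Beurling_derivative_bound:
  assumes "f \<in> GS_Beurling \<theta> s"
  obtains C where "smooth f" "\<And>n x. cmod ((vderiv ^^ n) f x) \<le> C * fact n powr s"
proof -
  from assms have "f \<in> GS \<theta> s 1" by (auto simp: GS_Beurling_def)
  then have sm: "smooth f" and "bdd_above (range (\<lambda>(\<alpha>::nat, \<beta>::nat, x::real).
       cmod (complex_of_real x ^ \<alpha> * (D ^^ \<beta>) f x) /
         (1 ^ (\<alpha> + \<beta>) * fact \<alpha> powr \<theta> * fact \<beta> powr s)))"
    by (auto simp: GS_def)
  then obtain C where C: "\<And>\<alpha> \<beta> x. cmod (complex_of_real x ^ \<alpha> * (D ^^ \<beta>) f x) /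
         (1 ^ (\<alpha> + \<beta>) * fact \<alpha> powr \<theta> * fact \<beta> powr s) \<le> C"
    unfolding bdd_above_def by fastforce
  have "cmod ((vderiv ^^ n) f x) \<le> C * fact n powr s" for n x
    using C[of x 0 n] by (simp add: cmod_D_power[OF sm] divide_le_eq)
  then show ?thesis by (rule that[OF sm])
qed

lemma vderiv_power_of_holomorphic:
  assumes "g holomorphic_on S" "open S" "range of_real \<subseteq> S"
  shows "(vderiv ^^ n) (\<lambda>x. g (of_real x)) = (\<lambda>x. (deriv ^^ n) g (of_real x))"
    and "((\<lambda>x. (deriv ^^ n) g (of_real x)) has_vector_derivative (deriv ^^ Suc n) g (of_real x)) (at x)"
proof -
  have step: "((\<lambda>x. (deriv ^^ n) g (of_real x)) has_vector_derivative (deriv ^^ Suc n) g (of_real x)) (at x)" for n x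
    using holomorphic_derivI[OF holomorphic_higher_deriv[OF assms(1,2)] assms(2), of "of_real x" n UNIV] assms(3)
    by (intro has_vector_derivative_real_field) auto
  then show "((\<lambda>x. (deriv ^^ n) g (of_real x)) has_vector_derivative (deriv ^^ Suc n) g (of_real x)) (at x)" .
  show "(vderiv ^^ n) (\<lambda>x. g (of_real x)) = (\<lambda>x. (deriv ^^ n) g (of_real x))"
  proof (induction n)
    case (Suc n)
    have "(vderiv ^^ Suc n) (\<lambda>x. g (of_real x)) = vderiv (\<lambda>x. (deriv ^^ n) g (of_real x))"
      by (simp only: funpow.simps o_apply Suc.IH)
    also have "\<dots> = (\<lambda>x. (deriv ^^ Suc n) g (of_real x))"
      by (intro ext vector_derivative_at step)
    finally show ?case .
  qed simp
qed

text \<open>Cauchy's inequality on discs of a fixed radius \<open>\<delta>\<close> costs \<open>fact n / \<delta> ^ n\<close> for the \<open>n\<close>-th derivative and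
keeps the decay in \<open>x\<close>, and this decay bounds \<open>\<bar>x\<bar> ^ n\<close> by \<open>fact n powr \<theta>'\<close> times a geometric factor.
Since \<open>1 < s\<close> and \<open>\<theta>' < \<theta>\<close>, the geometric factors, including the arbitrary \<open>h\<close>, are absorbed by
\<open>power_le_exp_fact_powr\<close>.\<close>

lemma holomorphic_decay_in_GS_Beurling:
  assumes hol: "g holomorphic_on S" and "open S" and \<delta>: "\<delta> > 0"
    and disc: "\<And>x. cball (of_real x) \<delta> \<subseteq> S"
    and decay: "\<And>x z. cmod (z - of_real x) = \<delta> \<Longrightarrow> cmod (g z) \<le> exp (- c * \<bar>x\<bar> powr (1 / \<theta>'))"
    and c: "c > 0" and \<theta>': "0 < \<theta>'" "\<theta>' < \<theta>" and s: "1 < s"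
  shows "(\<lambda>x. g (of_real x)) \<in> GS_Beurling \<theta> s"
  unfolding GS_Beurling_def
proof (rule INT_I)
  fix h :: real assume "h \<in> {0<..}"
  then have h: "h > 0" by simp
  let ?f = "\<lambda>x. g (of_real x)"
  have S: "range of_real \<subseteq> S"
  proof -
    have "of_real x \<in> cball (complex_of_real x) \<delta>" for x using \<delta> by simp
    then show ?thesis using disc by blast
  qed
  note hol_deriv = vderiv_power_of_holomorphic[OF hol \<open>open S\<close> S]
  have sm: "smooth ?f"
    unfolding smooth_def hol_deriv(1) using hol_deriv(2) by (blast intro: differentiableI_vector)
  define E where "E x = exp (- c * \<bar>x\<bar> powr (1 / \<theta>'))" for x
  have cauchy: "cmod ((deriv ^^ n) g (of_real x)) \<le> fact n * E x / \<delta> ^ n" for n x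
  proof (rule Cauchy_inequality[OF _ _ \<delta>])
    show "g holomorphic_on ball (of_real x) \<delta>"
      using hol disc[of x] ball_subset_cball by (blast intro: holomorphic_on_subset)
    show "continuous_on (cball (of_real x) \<delta>) g"
      using hol disc[of x] by (blast intro: holomorphic_on_imp_continuous_on holomorphic_on_subset)
    show "cmod (g z) \<le> E x" if "cmod (of_real x - z) = \<delta>" for z
      using decay[of z x] that by (simp add: E_def norm_minus_commute)
  qed
  \<comment> \<open>Chosen so that the exponent produced by \<open>power_le_exp_fact_powr\<close> is exactly the rate of decay.\<close>
  define \<kappa> where "\<kappa> = (c / \<theta>') powr \<theta>'"
  have \<kappa>: "\<kappa> > 0" using c \<theta>' by (simp add: \<kappa>_def)
  have "\<theta>' * (\<kappa> * \<bar>x\<bar>) powr (1 / \<theta>') = c * \<bar>x\<bar> powr (1 / \<theta>')" for x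
    using c \<theta>' by (simp add: \<kappa>_def powr_mult powr_powr)
  then have "(\<kappa> * \<bar>x\<bar>) ^ n \<le> exp (c * \<bar>x\<bar> powr (1 / \<theta>')) * fact n powr \<theta>'" for n x
    using power_le_exp_fact_powr[of "\<kappa> * \<bar>x\<bar>" \<theta>' n] \<kappa> \<theta>' by simp
  then have moment: "\<bar>x\<bar> ^ n * E x \<le> fact n powr \<theta>' / \<kappa> ^ n" for n x
    using \<kappa> by (simp add: E_def exp_minus field_simps)
  define A where "A = exp ((\<theta> - \<theta>') * (1 / (\<kappa> * h)) powr (1 / (\<theta> - \<theta>')))"
  define B where "B = exp ((s - 1) * (1 / (\<delta> * h)) powr (1 / (s - 1)))"
  have main: "cmod (complex_of_real x ^ \<alpha> * (D ^^ \<beta>) ?f x) /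
         (h ^ (\<alpha> + \<beta>) * fact \<alpha> powr \<theta> * fact \<beta> powr s) \<le> A * B" for \<alpha> \<beta> x
  proof -
    have "cmod (complex_of_real x ^ \<alpha> * (D ^^ \<beta>) ?f x) = \<bar>x\<bar> ^ \<alpha> * cmod ((deriv ^^ \<beta>) g (of_real x))"
      by (simp only: norm_mult norm_power cmod_D_power[OF sm] hol_deriv(1) norm_of_real)
    also have "\<dots> \<le> \<bar>x\<bar> ^ \<alpha> * (fact \<beta> * E x / \<delta> ^ \<beta>)"
      by (intro mult_left_mono cauchy) simp
    also have "\<dots> = (\<bar>x\<bar> ^ \<alpha> * E x) * (fact \<beta> / \<delta> ^ \<beta>)" by simp
    also have "\<dots> \<le> (fact \<alpha> powr \<theta>' / \<kappa> ^ \<alpha>) * (fact \<beta> / \<delta> ^ \<beta>)"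
      by (intro mult_right_mono moment) (use \<delta> in simp)
    also have "\<dots> = h ^ (\<alpha> + \<beta>) * ((1 / (\<kappa> * h)) ^ \<alpha> * fact \<alpha> powr \<theta>') * ((1 / (\<delta> * h)) ^ \<beta> * fact \<beta>)"
      using h \<kappa> \<delta> by (simp add: power_add power_mult_distrib field_simps)
    also have "\<dots> \<le> h ^ (\<alpha> + \<beta>) * ((A * fact \<alpha> powr (\<theta> - \<theta>')) * fact \<alpha> powr \<theta>')
                      * ((B * fact \<beta> powr (s - 1)) * fact \<beta>)"
      unfolding A_def B_def
      by (intro mult_mono mult_left_mono mult_right_mono power_le_exp_fact_powr)
         (use h \<kappa> \<delta> \<theta>' s in auto)
    also have "\<dots> = A * B * (h ^ (\<alpha> + \<beta>) * fact \<alpha> powr \<theta> * fact \<beta> powr s)"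
      by (simp add: powr_diff mult_ac)
    finally show ?thesis
      using h by (subst divide_le_eq) auto
  qed
  show "?f \<in> GS \<theta> s h"
    unfolding GS_def using sm main by (auto intro!: bdd_aboveI)
qed

section \<open>A stretched exponential in the Beurling space\<close>

definition stretched_exp :: "real \<Rightarrow> complex \<Rightarrow> complex" where
  "stretched_exp p z = exp (- ((1 + z\<^sup>2) powr of_real p))"

lemma stretched_exp_of_real:
  "stretched_exp p (of_real x) = of_real (exp (- ((1 + x\<^sup>2) powr p)))"
proof -
  have "(1 + (complex_of_real x)\<^sup>2) powr of_real p = of_real ((1 + x\<^sup>2) powr p)"
    using powr_of_real[of "1 + x\<^sup>2" p] by simp
  then show ?thesis by (simp add: stretched_exp_def exp_of_real[symmetric])
qed

lemma Re_one_plus_square: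
  "Re (1 + z\<^sup>2) = 1 + (Re z)\<^sup>2 - (Im z)\<^sup>2"
  by (simp add: power2_eq_square)

text \<open>For \<open>\<bar>Im z\<bar> < 1\<close> the number \<open>1 + z\<^sup>2\<close> has positive real part and so avoids the branch cut of the
logarithm.\<close>

lemma holomorphic_stretched_exp:
  "stretched_exp p holomorphic_on {z. \<bar>Im z\<bar> < 1}"
proof -
  have "1 + z\<^sup>2 \<notin> \<real>\<^sub>\<le>\<^sub>0" if "\<bar>Im z\<bar> < 1" for z
  proof -
    have "Re (1 + z\<^sup>2) > 0"
      using that abs_square_less_1[of "Im z"] zero_le_power2[of "Re z"]
      unfolding Re_one_plus_square by linarith
    then show ?thesis by (auto simp: complex_nonpos_Reals_iff)
  qed
  then show ?thesis
    unfolding stretched_exp_def by (intro holomorphic_intros) auto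
qed

text \<open>The hypothesis makes the argument of \<open>w powr p\<close> at most \<open>1\<close> in absolute value, which is below
\<open>pi / 3\<close>, so the cosine of the argument is at least one half.\<close>

lemma Re_powr_ge_half:
  fixes w :: complex
  assumes "Re w > 0" "p > 0" "p * (\<bar>Im w\<bar> / Re w) \<le> 1"
  shows "Re (w powr of_real p) \<ge> Re w powr p / 2"
proof -
  have w: "w \<noteq> 0" using assms(1) by auto
  have "\<bar>Im (Ln w)\<bar> \<le> \<bar>Im w\<bar> / Re w"
    using abs_arctan_le[of "Im w / Re w"] assms(1) w
    by (simp add: Arg_eq_Im_Ln[symmetric] arg_conv_arctan)
  then have "p * \<bar>Im (Ln w)\<bar> \<le> p * (\<bar>Im w\<bar> / Re w)"
    using assms(2) by (intro mult_left_mono) auto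
  then have le1: "\<bar>p * Im (Ln w)\<bar> \<le> 1"
    using assms(2,3) by (simp add: abs_mult)
  have "cos (pi / 3) \<le> cos \<bar>p * Im (Ln w)\<bar>"
    using le1 pi_gt3 by (intro cos_monotone_0_pi_le) auto
  then have c: "1 / 2 \<le> cos (p * Im (Ln w))"
    by (simp add: cos_60)
  have "Re w powr p \<le> cmod w powr p"
    using assms complex_Re_le_cmod[of w] by (intro powr_mono2) auto
  then have "Re w powr p * (1 / 2) \<le> cmod w powr p * cos (p * Im (Ln w))"
    using c by (intro mult_mono) auto
  also have "\<dots> = Re (w powr of_real p)"
    using w by (simp add: powr_def Re_exp)
  finally show ?thesis by simp
qed

text \<open>On a strip of half-width \<open>\<delta>\<close> the argument of \<open>1 + z\<^sup>2\<close> is at most \<open>2 * \<delta>\<close> in absolute value,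
and \<open>\<delta>\<close> is so small that multiplication by \<open>p\<close> keeps it below \<open>1\<close>. The real part of \<open>(1 + z\<^sup>2) powr p\<close> therefore remains
comparable to \<open>\<bar>x\<bar> powr (2 * p)\<close>, even when \<open>p\<close> is large.\<close>

lemma stretched_exp_decay:
  assumes p: "p > 0" and \<delta>: "\<delta> = 1 / (2 + 2 * p)"
    and z: "cmod (z - of_real x) = \<delta>"
  shows "cmod (stretched_exp p z) \<le> exp (- (1 / 2 * (1 / 2) powr p) * \<bar>x\<bar> powr (2 * p))"
proof -
  define w where "w = 1 + z\<^sup>2"
  define a b e where "a = Re z" and "b = Im z" and "e = a - x"
  have \<delta>': "0 < \<delta>" "\<delta> \<le> 1 / 2" "p * (2 * \<delta>) \<le> 1"
    using p by (auto simp: \<delta> field_simps)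
  have b: "\<bar>b\<bar> \<le> \<delta>" and e: "\<bar>e\<bar> \<le> \<delta>"
    using abs_Im_le_cmod[of "z - of_real x"] abs_Re_le_cmod[of "z - of_real x"] z
    by (auto simp: a_def b_def e_def)
  have b2: "b\<^sup>2 \<le> 1 / 4" and e2: "e\<^sup>2 \<le> 1 / 4"
    using power_mono[of "\<bar>b\<bar>" "1/2" 2] power_mono[of "\<bar>e\<bar>" "1/2" 2] b e \<delta>'
    by (auto simp: power2_eq_square)
  have Re: "Re w = 1 + a\<^sup>2 - b\<^sup>2" and Im: "Im w = 2 * a * b"
    by (auto simp: w_def a_def b_def power2_eq_square)
  have Re1: "Re w \<ge> (1 + a\<^sup>2) / 2" using b2 zero_le_power2[of a] unfolding Re by argo
  then have Re0: "Re w > 0" using zero_le_power2[of a] by argo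
  have "2 * \<bar>a\<bar> \<le> 1 + a\<^sup>2"
    using sum_squares_bound[of "\<bar>a\<bar>" 1] by simp
  then have "\<bar>Im w\<bar> \<le> (1 + a\<^sup>2) * \<delta>"
    unfolding Im abs_mult using b by (intro mult_mono) auto
  also have "\<dots> \<le> (2 * Re w) * \<delta>"
    using Re1 \<delta>' by (intro mult_right_mono) auto
  finally have "\<bar>Im w\<bar> / Re w \<le> 2 * \<delta>"
    using Re0 by (simp add: divide_le_eq mult_ac)
  then have "p * (\<bar>Im w\<bar> / Re w) \<le> p * (2 * \<delta>)"
    using p by (intro mult_left_mono) auto
  then have main: "Re w powr p / 2 \<le> Re (w powr of_real p)"
    using Re_powr_ge_half[OF Re0 p] \<delta>' by linarith
  have "x\<^sup>2 / 2 \<le> Re w"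
  proof -
    have "a = x + e" by (simp add: e_def)
    then have "2 * a\<^sup>2 = x\<^sup>2 - 2 * e\<^sup>2 + (x + 2 * e)\<^sup>2"
      by (simp add: power2_eq_square algebra_simps)
    then have "x\<^sup>2 - 2 * e\<^sup>2 \<le> 2 * a\<^sup>2" by simp
    then show ?thesis using b2 e2 unfolding Re by argo
  qed
  then have "(x\<^sup>2 / 2) powr p \<le> Re w powr p"
    using p by (intro powr_mono2) auto
  moreover have "(x\<^sup>2 / 2) powr p = (1 / 2) powr p * \<bar>x\<bar> powr (2 * p)"
  proof -
    have sq: "x\<^sup>2 = \<bar>x\<bar> powr 2" by (cases "x = 0") simp_all
    have "(x\<^sup>2 / 2) powr p = (1 / 2 * x\<^sup>2) powr p" by simp
    also have "\<dots> = (1 / 2) powr p * (x\<^sup>2) powr p" by (subst powr_mult) simp_all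
    also have "(x\<^sup>2) powr p = \<bar>x\<bar> powr (2 * p)" unfolding sq by (simp only: powr_powr)
    finally show ?thesis .
  qed
  ultimately have "1 / 2 * (1 / 2) powr p * \<bar>x\<bar> powr (2 * p) \<le> Re (w powr of_real p)"
    using main by simp
  then show ?thesis
    by (simp add: stretched_exp_def w_def)
qed

lemma stretched_exp_in_GS_Beurling:
  assumes "p > 0" "1 / (2 * p) < \<theta>" "1 < s"
  shows "(\<lambda>x. stretched_exp p (of_real x)) \<in> GS_Beurling \<theta> s"
proof -
  define \<delta> where "\<delta> = 1 / (2 + 2 * p)"
  have \<delta>: "0 < \<delta>" "\<delta> < 1" using assms(1) by (auto simp: \<delta>_def)
  show ?thesis
  proof (rule holomorphic_decay_in_GS_Beurling[OF holomorphic_stretched_exp _ \<delta>(1), where \<theta>' = "1 / (2 * p)"])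
    show "open {z. \<bar>Im z\<bar> < 1}" by (intro open_Collect_less continuous_intros)
    show "cball (of_real x) \<delta> \<subseteq> {z. \<bar>Im z\<bar> < 1}" for x
    proof
      fix z assume "z \<in> cball (complex_of_real x) \<delta>"
      then have "cmod (z - of_real x) \<le> \<delta>" by (simp add: dist_norm norm_minus_commute)
      then show "z \<in> {z. \<bar>Im z\<bar> < 1}"
        using abs_Im_le_cmod[of "z - of_real x"] \<delta> by simp
    qed
    show "cmod (stretched_exp p z) \<le> exp (- (1 / 2 * (1 / 2) powr p) * \<bar>x\<bar> powr (1 / (1 / (2 * p))))"
      if "cmod (z - of_real x) = \<delta>" for x z
      using stretched_exp_decay[OF assms(1) \<delta>_def that] by simp
  qed (use assms in auto)
qed

section \<open>Half-period sampling of a polynomial chirp\<close>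

lemma poly_eventually_comparable:
  fixes q :: "real poly"
  assumes "q \<noteq> 0"
  shows "\<forall>\<^sub>F x in at_top. \<bar>lead_coeff q\<bar> / 2 * x ^ degree q \<le> \<bar>poly q x\<bar>
           \<and> \<bar>poly q x\<bar> \<le> 2 * \<bar>lead_coeff q\<bar> * x ^ degree q"
proof -
  let ?l = "\<bar>lead_coeff q\<bar>"
  have l: "?l > 0" using assms by simp
  have "((\<lambda>x. poly q x / x ^ degree q) \<longlongrightarrow> lead_coeff q) at_top"
    by (rule tendsto_mono[OF at_top_le_at_infinity poly_divide_tendsto_aux])
  then have lim: "((\<lambda>x. \<bar>poly q x / x ^ degree q\<bar>) \<longlongrightarrow> ?l) at_top"
    by (rule tendsto_rabs)
  have "\<forall>\<^sub>F x in at_top. ?l / 2 < \<bar>poly q x / x ^ degree q\<bar>"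
    using l by (intro order_tendstoD(1)[OF lim]) simp
  moreover have "\<forall>\<^sub>F x in at_top. \<bar>poly q x / x ^ degree q\<bar> < 2 * ?l"
    using l by (intro order_tendstoD(2)[OF lim]) simp
  ultimately show ?thesis
    using eventually_gt_at_top[of 0]
  proof eventually_elim
    case (elim x)
    then have "\<bar>poly q x / x ^ degree q\<bar> = \<bar>poly q x\<bar> / x ^ degree q"
      by (simp add: abs_divide)
    with elim show ?case by (simp add: field_simps)
  qed
qed

text \<open>The first derivative is the frequency of the chirp, bounded below to make the half period short;
the second one governs how far the phase departs from a linear one on a window of length one.\<close>

lemma polynomial_phase_bounds:
  fixes q :: "real poly"
  assumes deg: "degree q \<ge> 2"
  obtains a B where "a > 0" "B > 0"
    "\<forall>\<^sub>F x in at_top. a * x ^ (degree q - 1) \<le> \<bar>poly (pderiv q) x\<bar>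
       \<and> (\<forall>y\<in>{x..x + 1}. \<bar>poly (pderiv (pderiv q)) y\<bar> \<le> B * x ^ (degree q - 2))"
proof -
  define l1 l2 where "l1 = \<bar>lead_coeff (pderiv q)\<bar>" and "l2 = \<bar>lead_coeff (pderiv (pderiv q))\<bar>"
  have nz: "pderiv q \<noteq> 0" "pderiv (pderiv q) \<noteq> 0"
    using deg by (auto simp: pderiv_eq_0_iff degree_pderiv)
  define B where "B = 2 * l2 * 2 ^ (degree q - 2)"
  have pos: "l1 > 0" "l2 > 0" "B > 0" using nz by (auto simp: l1_def l2_def B_def)
  obtain Y where Y: "\<And>y. y \<ge> Y \<Longrightarrow> \<bar>poly (pderiv (pderiv q)) y\<bar> \<le> 2 * l2 * y ^ (degree q - 2)"
    using poly_eventually_comparable[OF nz(2)] deg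
    by (auto simp: eventually_at_top_linorder degree_pderiv l2_def numeral_2_eq_2)
  have "\<forall>\<^sub>F x in at_top. l1 / 2 * x ^ (degree q - 1) \<le> \<bar>poly (pderiv q) x\<bar>"
    using poly_eventually_comparable[OF nz(1)] by (auto simp: degree_pderiv l1_def elim: eventually_mono)
  then have "\<forall>\<^sub>F x in at_top. l1 / 2 * x ^ (degree q - 1) \<le> \<bar>poly (pderiv q) x\<bar>
       \<and> (\<forall>y\<in>{x..x + 1}. \<bar>poly (pderiv (pderiv q)) y\<bar> \<le> B * x ^ (degree q - 2))"
    using eventually_ge_at_top[of "max 1 Y"]
  proof eventually_elim
    case (elim x)
    have "\<bar>poly (pderiv (pderiv q)) y\<bar> \<le> B * x ^ (degree q - 2)" if "y \<in> {x..x + 1}" for y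
    proof -
      have "\<bar>poly (pderiv (pderiv q)) y\<bar> \<le> 2 * l2 * y ^ (degree q - 2)"
        using Y elim that by auto
      also have "\<dots> \<le> 2 * l2 * (2 * x) ^ (degree q - 2)"
        using pos elim that by (intro mult_left_mono power_mono) auto
      finally show ?thesis by (simp add: B_def power_mult_distrib mult_ac)
    qed
    with elim show ?case by simp
  qed
  then show ?thesis using that[of "l1 / 2" B] pos by simp
qed

lemma poly_linearization_error:
  fixes q :: "real poly"
  assumes K: "\<And>y. y \<in> {x..x + 1} \<Longrightarrow> \<bar>poly (pderiv (pderiv q)) y\<bar> \<le> K"
    and v: "0 \<le> v" "v \<le> 1"
  shows "\<bar>poly q (x + v) - poly q x - v * poly (pderiv q) x\<bar> \<le> K * v\<^sup>2"
proof -
  obtain \<xi> where \<xi>: "\<xi> \<in> {x..x + v}" "poly q (x + v) - poly q x = v * poly (pderiv q) \<xi>"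
    using poly_MVT'[of x "x + v" "{x..x + v}" q] v by auto
  have "\<exists>\<eta>\<in>{x..\<xi>}. poly (pderiv q) \<xi> - poly (pderiv q) x = (\<xi> - x) * poly (pderiv (pderiv q)) \<eta>"
    by (rule poly_MVT') (use \<xi>(1) in simp)
  then obtain \<eta> where \<eta>: "\<eta> \<in> {x..\<xi>}"
    "poly (pderiv q) \<xi> - poly (pderiv q) x = (\<xi> - x) * poly (pderiv (pderiv q)) \<eta>"
    by blast
  have "\<bar>poly q (x + v) - poly q x - v * poly (pderiv q) x\<bar>
      = v * ((\<xi> - x) * \<bar>poly (pderiv (pderiv q)) \<eta>\<bar>)"
  proof -
    have "poly q (x + v) - poly q x - v * poly (pderiv q) x
        = v * ((\<xi> - x) * poly (pderiv (pderiv q)) \<eta>)"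
      unfolding \<xi>(2) \<eta>(2)[symmetric] by (simp add: algebra_simps)
    then show ?thesis using v \<xi>(1) by (simp add: abs_mult)
  qed
  also have "\<dots> \<le> v * (v * K)"
    using K[of \<eta>] \<xi>(1) \<eta>(1) v by (intro mult_left_mono mult_mono) auto
  finally show ?thesis by (simp add: power2_eq_square mult_ac)
qed

text \<open>Advancing by \<open>j\<close> half periods changes the linearized phase by \<open>\<plusminus> j * pi\<close>, hence contributes the sign
\<open>(-1) ^ j\<close>. The remaining phase error has absolute value at most \<open>1\<close>, so its cosine is at least one half.\<close>

lemma Re_chirp_half_period_samples:
  fixes q :: "real poly" and f :: "real \<Rightarrow> real" and x :: real
  defines "N \<equiv> poly (pderiv q) x"
  assumes K: "\<And>y. y \<in> {x..x + 1} \<Longrightarrow> \<bar>poly (pderiv (pderiv q)) y\<bar> \<le> K"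
    and N: "N \<noteq> 0" and t: "t = pi / \<bar>N\<bar>"
    and nt: "real n * t \<le> 1" "K * (real n * t)\<^sup>2 \<le> 1" and j: "j \<le> n"
    and f: "\<And>y. y \<in> {x..x + 1} \<Longrightarrow> b \<le> f y" and b: "b \<ge> 0"
  shows "b / 2 \<le> Re (exp (- \<i> * of_real (poly q x)) * (-1) ^ j
                     * chirp q (\<lambda>y. of_real (f y)) (x + real j * t))"
proof -
  define v where "v = real j * t"
  define e where "e = poly q (x + v) - poly q x - v * N"
  have t0: "t > 0" using N by (simp add: t)
  have v: "0 \<le> v" "v \<le> real n * t" using t0 j by (auto simp: v_def)
  have K0: "K \<ge> 0" using K[of x] by simp
  have "\<bar>e\<bar> \<le> K * v\<^sup>2"
    unfolding e_def N_def using poly_linearization_error[OF K] v nt by auto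
  also have "\<dots> \<le> K * (real n * t)\<^sup>2"
    using v K0 by (intro mult_left_mono power_mono) auto
  finally have e: "\<bar>e\<bar> \<le> 1" using nt by simp
  have "cos (pi / 3) \<le> cos \<bar>e\<bar>"
    using e pi_gt3 by (intro cos_monotone_0_pi_le) auto
  then have ce: "1 / 2 \<le> cos e" by (simp add: cos_60)
  have vN: "v * N = real j * pi \<or> v * N = - (real j * pi)"
    using N by (auto simp: v_def t abs_if)
  have "poly q (x + v) - poly q x = v * N + e" by (simp add: e_def)
  then have "cos (poly q (x + v) - poly q x) = (-1) ^ j * cos e"
    using vN by (auto simp: cos_add cos_diff)
  then have *: "(-1) ^ j * cos (poly q (x + v) - poly q x) = cos e"
    by (simp flip: power_mult_distrib mult.assoc)
  have "b * (1 / 2) \<le> f (x + v) * cos e"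
    using f[of "x + v"] ce b v nt by (intro mult_mono) auto
  also have "\<dots> = Re (of_real ((-1) ^ j * f (x + v)) * cis (poly q (x + v) - poly q x))"
    by (simp flip: *)
  also have "of_real ((-1) ^ j * f (x + v)) * cis (poly q (x + v) - poly q x)
      = exp (- \<i> * of_real (poly q x)) * (-1) ^ j * chirp q (\<lambda>y. of_real (f y)) (x + real j * t)"
    by (simp add: chirp_def v_def cis_conv_exp exp_diff exp_minus algebra_simps divide_inverse)
  finally show ?thesis by simp
qed

section \<open>The chirped function leaves the space\<close>

text \<open>The sampling point \<open>x = n powr r\<close> balances the two effects: there the stretched exponential is only
exponentially small in \<open>n\<close>, whereas the frequency, of size \<open>n powr (r * (m - 1))\<close>, enters with the power
\<open>n\<close> and beats \<open>fact n powr s\<close> because \<open>s < r * (m - 1)\<close>. The hypothesis \<open>2 < r * m\<close> keeps the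
phase linear over the \<open>n\<close> half periods in use.\<close>

lemma chirp_stretched_exp_derivatives_outgrow:
  fixes q :: "real poly" and r s C :: real and G :: "nat \<Rightarrow> real \<Rightarrow> complex"
  assumes deg: "degree q = m" "m \<ge> 2" and r: "r > 0" and s: "1 \<le> s"
    and rm: "2 < r * real m" "s < r * (real m - 1)"
    and G0: "G 0 = chirp q (\<lambda>x. stretched_exp (1 / (2 * r)) (of_real x))"
    and der: "\<And>n x. (G n has_vector_derivative G (Suc n) x) (at x)"
    and bound: "\<And>n x. cmod (G n x) \<le> C * fact n powr s"
  shows False
proof -
  define p where "p = 1 / (2 * r)"
  have p: "p > 0" "r * (2 * p) = 1" using r by (auto simp: p_def)
  obtain a B where aB: "a > 0" "B > 0" and phase:
    "\<forall>\<^sub>F x in at_top. a * x ^ (m - 1) \<le> \<bar>poly (pderiv q) x\<bar>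
       \<and> (\<forall>y\<in>{x..x + 1}. \<bar>poly (pderiv (pderiv q)) y\<bar> \<le> B * x ^ (m - 2))"
    using polynomial_phase_bounds[of q] deg by auto
  define A where "A = pi / a"
  have A: "A > 0" using aB by (simp add: A_def)
  define L where "L = 5 powr p"
  have C: "C \<ge> 0" using bound[of 0 0] norm_ge_zero[of "G 0 0"] by (simp del: norm_ge_zero)
  have xlim: "filterlim (\<lambda>n. real n powr r) at_top sequentially"
  proof -
    have "filterlim (\<lambda>n. exp (r * ln (real n))) at_top sequentially"
      by (intro filterlim_compose[OF exp_at_top] filterlim_compose[OF ln_at_top]
            filterlim_tendsto_pos_mult_at_top[OF tendsto_const r] filterlim_real_sequentially)
    then show ?thesis
      by (rule filterlim_mono_eventually)
         (auto intro!: eventually_mono[OF eventually_gt_at_top[of 0]] simp: powr_def)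
  qed
  have decay: "\<forall>\<^sub>F n in sequentially. c * real n powr - \<gamma> < \<epsilon>" if "\<gamma> > 0" "\<epsilon> > 0" for c \<gamma> \<epsilon> :: real
  proof -
    have "(\<lambda>n. c * real n powr - \<gamma>) \<longlonglongrightarrow> c * 0"
      using that by (intro tendsto_mult tendsto_const tendsto_neg_powr filterlim_real_sequentially) auto
    then show ?thesis using that by (intro order_tendstoD(2)) auto
  qed
  \<comment> \<open>These say, in order, that the samples stay in a window of length one, that the phase error is
      small, that the frequency beats both the factorial and the decay, and that the gain \<open>2 ^ n\<close> of
      the alternating difference exceeds the constant.\<close>
  have e1: "\<forall>\<^sub>F n in sequentially. A * real n powr - (r * (real m - 1) - 1) < 1"
    using rm s by (intro decay) auto
  have e2: "\<forall>\<^sub>F n in sequentially. B * A\<^sup>2 * real n powr - (r * real m - 2) < 1"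
    using rm by (intro decay) auto
  have e3: "\<forall>\<^sub>F n in sequentially. A * real n powr - (r * (real m - 1) - s) < exp (- L)"
    using rm by (intro decay) auto
  have e4: "\<forall>\<^sub>F n in sequentially. 2 * C < 2 ^ n"
  proof -
    obtain k where k: "2 * C < 2 ^ k" using real_arch_pow[of 2 "2 * C"] by auto
    have "2 * C < 2 ^ n" if "n \<ge> k" for n
      by (rule less_le_trans[OF k power_increasing[OF that]]) simp
    then show ?thesis by (auto simp: eventually_sequentially)
  qed
  have "\<forall>\<^sub>F n in sequentially. False"
    using e1 e2 e3 e4 eventually_compose_filterlim[OF phase xlim]
      eventually_compose_filterlim[OF eventually_ge_at_top[of 1] xlim] eventually_gt_at_top[of 0]
  proof eventually_elim
    case (elim n)
    define x where "x = real n powr r"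
    define N where "N = poly (pderiv q) x"
    define t where "t = pi / \<bar>N\<bar>"
    define K where "K = B * x ^ (m - 2)"
    define b where "b = exp (- L * real n)"
    have n: "real n > 0" using elim by simp
    have x1: "x \<ge> 1" using elim by (simp add: x_def)
    have x_pow: "x ^ k = real n powr (r * real k)" for k
      using n by (simp add: x_def powr_powr flip: powr_realpow)
    have N: "a * x ^ (m - 1) \<le> \<bar>N\<bar>" using elim by (simp add: N_def x_def)
    have ax: "a * x ^ (m - 1) > 0" using aB x1 by simp
    have N0: "N \<noteq> 0" using N ax by auto
    have "t \<le> pi / (a * x ^ (m - 1))"
      unfolding t_def using N ax by (intro frac_le) auto
    also have "\<dots> = A * real n powr - (r * (real m - 1))"
      unfolding x_pow powr_minus A_def using deg by (simp add: divide_inverse of_nat_diff)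
    finally have t: "t \<le> A * real n powr - (r * (real m - 1))" .
    have t0: "t \<ge> 0" by (simp add: t_def)
    have "real n * t \<le> real n * (A * real n powr - (r * (real m - 1)))"
      using t by (intro mult_left_mono) auto
    also have "\<dots> = A * real n powr - (r * (real m - 1) - 1)"
    proof -
      have "- (r * (real m - 1) - 1) = 1 + - (r * (real m - 1))" by simp
      then show ?thesis using n by (simp only: powr_add) simp
    qed
    finally have nt: "real n * t \<le> A * real n powr - (r * (real m - 1) - 1)" .
    have "K * (real n * t)\<^sup>2 \<le> K * (A * real n powr - (r * (real m - 1) - 1))\<^sup>2"
      using nt t0 aB x1 by (intro mult_left_mono power_mono) (auto simp: K_def)
    also have "\<dots> = B * A\<^sup>2 * (real n powr (r * real (m - 2))
        * (real n powr - (r * (real m - 1) - 1) * real n powr - (r * (real m - 1) - 1)))"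
      by (simp add: K_def x_pow power2_eq_square)
    also have "\<dots> = B * A\<^sup>2 * real n powr - (r * real m - 2)"
    proof -
      have "r * real (m - 2) + (- (r * (real m - 1) - 1) + - (r * (real m - 1) - 1)) = - (r * real m - 2)"
        using deg by (simp add: of_nat_diff algebra_simps)
      then show ?thesis by (simp only: powr_add[symmetric])
    qed
    finally have Knt: "K * (real n * t)\<^sup>2 \<le> 1" using elim by linarith
    have b: "b \<le> exp (- ((1 + y\<^sup>2) powr p))" if y: "y \<in> {x..x + 1}" for y
    proof -
      have "y \<le> 2 * x" "0 \<le> y" using y x1 by auto
      then have "y\<^sup>2 \<le> (2 * x)\<^sup>2" by (intro power_mono)
      moreover have "1 \<le> x\<^sup>2" using x1 by simp
      ultimately have "1 + y\<^sup>2 \<le> 5 * x\<^sup>2" by (simp add: power_mult_distrib)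
      then have "(1 + y\<^sup>2) powr p \<le> (5 * x\<^sup>2) powr p"
        using p by (intro powr_mono2) (auto intro: add_nonneg_nonneg)
      also have "\<dots> = L * real n powr (r * 2 * p)"
        using x_pow[of 2] by (simp add: L_def powr_mult powr_powr)
      also have "\<dots> = L * real n"
        using p n by (simp add: mult.assoc)
      finally show ?thesis by (simp add: b_def)
    qed
    have "2 ^ n * (b / 2) \<le> t ^ n * (C * fact n powr s)"
    proof (rule alternating_samples_bound[where G = G, OF der bound _ t0])
      show "cmod (exp (- \<i> * of_real (poly q x))) = 1" by simp
      fix j assume "j \<le> n"
      then show "b / 2 \<le> Re (exp (- \<i> * of_real (poly q x)) * (-1) ^ j * G 0 (x + real j * t))"
        unfolding G0 stretched_exp_of_real p_def[symmetric]
      proof (intro Re_chirp_half_period_samples)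
        show "\<bar>poly (pderiv (pderiv q)) y\<bar> \<le> K" if "y \<in> {x..x + 1}" for y
          using elim that by (simp add: K_def x_def)
        show "real n * t \<le> 1" using nt elim by linarith
      qed (use N0 Knt b in \<open>auto simp: N_def t_def b_def\<close>)
    qed
    also have "fact n powr s \<le> (real n ^ n) powr s"
      using s fact_le_power[of n, where 'a = real] by (intro powr_mono2) auto
    also have "(real n ^ n) powr s = (real n powr s) ^ n"
      using n by (simp add: powr_powr mult.commute flip: powr_realpow)
    also have "t ^ n * (C * (real n powr s) ^ n) = C * (t * real n powr s) ^ n"
      by (simp add: power_mult_distrib)
    also have "\<dots> \<le> C * exp (- L) ^ n"
    proof (intro mult_left_mono power_mono C)
      have "t * real n powr s \<le> A * real n powr - (r * (real m - 1)) * real n powr s"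
        using t by (intro mult_right_mono) auto
      also have "\<dots> = A * real n powr - (r * (real m - 1) - s)"
        by (simp add: mult.assoc flip: powr_add)
      finally show "t * real n powr s \<le> exp (- L)" using elim by linarith
    qed (use t0 in auto)
    also have "exp (- L) ^ n = b" by (simp add: b_def mult.commute flip: exp_of_nat_mult)
    finally have "2 ^ n * (b / 2) \<le> C * b" using t0 C by (simp add: mult_left_mono)
    then have "2 ^ n \<le> 2 * C" by (simp add: b_def)
    then show False using elim by linarith
  qed
  then show False by simp
qed

theorem theorem1p3:
  fixes q :: "real poly" and m :: nat and s \<theta> :: real
  assumes "degree q = m" and "m \<ge> 2"
    and "s > 0" and "\<theta> > 0"
    and "1 < s" and "s < \<theta> * real m - max \<theta> 1"
    and "m = 3 \<longrightarrow> \<theta> > 1"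
  shows "\<not> (chirp q ` GS_Beurling \<theta> s \<subseteq> GS_Beurling \<theta> s)"
proof
  assume sub: "chirp q ` GS_Beurling \<theta> s \<subseteq> GS_Beurling \<theta> s"
  have m: "real m - 1 > 0" using assms(2) by simp
  \<comment> \<open>The hypotheses give \<open>s < \<theta> * m - \<theta>\<close> and, since \<open>1 < s\<close>, also \<open>2 < \<theta> * m\<close>; both strict inequalities
      survive a slight decrease of \<open>\<theta>\<close> to \<open>r\<close>.\<close>
  have "2 / real m < \<theta>" using assms m by (simp add: field_simps)
  moreover have "s / (real m - 1) < \<theta>" using assms m by (simp add: field_simps)
  ultimately obtain r where r: "max (2 / real m) (s / (real m - 1)) < r" "r < \<theta>"
    using dense[of "max (2 / real m) (s / (real m - 1))" \<theta>] by auto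
  have r2: "2 < r * real m" "s < r * (real m - 1)"
    using r(1) m by (auto simp: divide_less_eq)
  have r0: "r > 0" using r(1) assms(2) by (smt (verit) divide_nonneg_nonneg of_nat_0_le_iff)
  define f where "f = (\<lambda>x. stretched_exp (1 / (2 * r)) (of_real x))"
  have "f \<in> GS_Beurling \<theta> s"
    unfolding f_def using r0 r assms by (intro stretched_exp_in_GS_Beurling) auto
  then have "chirp q f \<in> GS_Beurling \<theta> s" using sub by blast
  then obtain C where sm: "smooth (chirp q f)"
    and C: "\<And>n x. cmod ((vderiv ^^ n) (chirp q f) x) \<le> C * fact n powr s"
    using GS_Beurling_derivative_bound by blast
  show False
  proof (rule chirp_stretched_exp_derivatives_outgrow)
    show "(vderiv ^^ 0) (chirp q f) = chirp q (\<lambda>x. stretched_exp (1 / (2 * r)) (of_real x))"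
      by (simp add: f_def)
  qed (use assms r0 r2 C smooth_has_vector_derivative[OF sm] in auto)
qed

end
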